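(* Let $k\ge1$, $m\ge 1$, and consider a polynomial depth-one recurrence in $k$ variables ${\bf z}^i=(z_0^i,\dots,z_{k-1}^i)^T\in\mathbb{C}^k$, $z^i_p=F_{p+1}({\bf z}^{i-1})$ for $i\ge1$, with $$F_{p+1}({\bf w})={}^{0}_{p}C+\sum_{j=1}^{m}\sum_{l_1,\dots,l_j=0}^{k-1}{}^{j}_{p}C_{l_1,\dots,l_j}\prod_{s=1}^{j}w_{l_s},\qquad 0\le p\le k-1,$$ where ${}^{j}_{p}C_{l_1,\dots,l_j}=0$ unless $l_1\le\dots\le l_j$, and suppose that its non-redundant transition matrix $\tilde T$ (defined in the context) is upper triangular. Let $\lambda_0,\dots,\lambda_{k-1}$ be the eigenvalues of the $k\times k$ matrix ${}^{1}{\bf C}=({}^{1}_{p}C_{l})_{p,l}$, all nonzero and with $|\lambda_0|\neq1$. A sufficient condition for $\tilde T$ to be diagonalizable is that the system $$\begin{cases}x_0+x_1\log_{|\lambda_0|}|\lambda_1|+\dots+x_{k-1}\log_{|\lambda_0|}|\lambda_{k-1}|=0\\ \operatorname{Arg}(\lambda_0)x_0+\operatorname{Arg}(\lambda_1)x_1+\dots+\operatorname{Arg}(\lambda_{k-1})x_{k-1}=2\pi t\end{cases}$$ has no non-trivial solution $x_0,\dots,x_{k-1},t\in\mathbb{Z}$. In the case $k=2$ this condition can be simplified to $$\log_{|\lambda_0|}|\lambda_1|\notin\mathbb{Q}\quad\text{or}\quad\frac{\pi}{\operatorname{Arg}(\lambda_1)-\operatorname{Arg}(\lambda_0)\log_{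|\lambda_0|}|\lambda_1|}\notin\mathbb{Q}.$$
   Context: Non-redundant transition matrix: list all monomials in $w_0,\dots,w_{k-1}$, each exactly once, written as $w_{l_1}\cdots w_{l_s}$ with $l_1\le\dots\le l_s$, ordered first by degree $s$ and within each degree lexicographically in $(l_1,\dots,l_s)$, indexed from $0$ (for $k=2$: $1,w_0,w_1,w_0^2,w_0w_1,w_1^2,\dots$). Then $\tilde T_{ab}$ ($a,b\ge0$) is the coefficient of monomial $b$ in the polynomial obtained from monomial $a$ by substituting $w_p\mapsto F_{p+1}({\bf w})$. If $\tilde{\bf y}^i$ is the vector of all these monomials evaluated at ${\bf z}^i$, then $\tilde{\bf y}^i=\tilde T\tilde{\bf y}^{i-1}$. Upper triangular means $\tilde T_{ab}=0$ for $a>b$. Diagonalizable means $\tilde T=PDP^{-1}$ with $D$ an infinite diagonal matrix and $P$ an invertible infinite upper triangular matrix (whose columns are eigenvectors of $\tilde T$). "Non-trivial" means that the integers are not all zero. In the $k=2$ condition, the second alternative presupposes that its denominator is nonzero. *)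

theory Defs
  imports
    "HOL-Analysis.Analysis"
    "HOL-Library.Poly_Mapping"
    "HOL-Library.Multiset"
    "HOL-Library.Infinite_Set"
    "HOL-Library.List_Lenlexorder"
    "Jordan_Normal_Form.Char_Poly"
begin

section \<open>Polynomials in the variables $w_0, w_1, \dots$\<close>

text \<open>
  The monomial $w_{l_1} \cdots w_{l_s}$ is the multiset of its variable indices, so that
  multiplication of monomials is addition of multisets, and a polynomial is a finitely supported
  family of coefficients, with the convolution product of \<^theory>\<open>HOL-Library.Poly_Mapping\<close>.
\<close>

type_synonym cpoly = "nat multiset \<Rightarrow>\<^sub>0 complex"

definition pconst :: "complex \<Rightarrow> cpoly" where
  "pconst c = Poly_Mapping.single {#} c"

definition pvar :: "nat \<Rightarrow> cpoly" where
  "pvar l = Poly_Mapping.single {#l#} 1"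

definition peval :: "cpoly \<Rightarrow> (nat \<Rightarrow> complex) \<Rightarrow> complex" where
  "peval f w = (\<Sum>\<mu>\<in>Poly_Mapping.keys f. Poly_Mapping.lookup f \<mu> * prod_mset (image_mset w \<mu>))"

section \<open>The recurrence and its non-redundant transition matrix\<close>

text \<open>
  \<open>C j p [l\<^sub>1, \<dots>, l\<^sub>j]\<close> is the coefficient ${}^{j}_{p}C_{l_1,\dots,l_j}$, and
  \<open>rec_poly k m C p\<close> is $F_{p+1}$.
\<close>

definition rec_poly :: "nat \<Rightarrow> nat \<Rightarrow> (nat \<Rightarrow> nat \<Rightarrow> nat list \<Rightarrow> complex) \<Rightarrow> nat \<Rightarrow> cpoly" where
  "rec_poly k m C p = pconst (C 0 p []) +
     (\<Sum>j = 1..m. \<Sum>ls \<in> {ls. length ls = j \<and> set ls \<subseteq> {..<k}}.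
        pconst (C j p ls) * prod_list (map pvar ls))"

text \<open>
  The list order of \<^theory>\<open>HOL-Library.List_Lenlexorder\<close> compares lengths first and lists of equal
  length lexicographically from the left; on sorted index lists this is the required order of the
  monomials, and \<^const>\<open>enumerate\<close> lists them increasingly, starting with index \<open>0\<close>.
\<close>

definition monom_list :: "nat \<Rightarrow> nat \<Rightarrow> nat list" where
  "monom_list k = enumerate {ls. sorted ls \<and> set ls \<subseteq> {..<k}}"

definition trans_matrix ::
    "nat \<Rightarrow> nat \<Rightarrow> (nat \<Rightarrow> nat \<Rightarrow> nat list \<Rightarrow> complex) \<Rightarrow> nat \<Rightarrow> nat \<Rightarrow> complex" where
  "trans_matrix k m C a b =
     Poly_Mapping.lookup (prod_list (map (rec_poly k m C) (monom_list k a))) (mset (monom_list k b))"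

definition linear_matrix :: "nat \<Rightarrow> (nat \<Rightarrow> nat \<Rightarrow> nat list \<Rightarrow> complex) \<Rightarrow> complex mat" where
  "linear_matrix k C = mat k k (\<lambda>(p, l). C 1 p [l])"

section \<open>Infinite matrices\<close>

type_synonym infmat = "nat \<Rightarrow> nat \<Rightarrow> complex"

definition inf_upper_triangular :: "infmat \<Rightarrow> bool" where
  "inf_upper_triangular A \<longleftrightarrow> (\<forall>a b. a > b \<longrightarrow> A a b = 0)"

definition inf_diagonal :: "infmat \<Rightarrow> bool" where
  "inf_diagonal A \<longleftrightarrow> (\<forall>a b. a \<noteq> b \<longrightarrow> A a b = 0)"

definition inf_one :: infmat where
  "inf_one = (\<lambda>a b. if a = b then 1 else 0)"

text \<open>
  The sum ranges over the indices with a nonzero term. There are finitely many of them whenever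
  \<open>B\<close> is upper triangular, and the product is only used in that case.
\<close>

definition inf_mult :: "infmat \<Rightarrow> infmat \<Rightarrow> infmat" where
  "inf_mult A B = (\<lambda>a b. Sum_any (\<lambda>c. A a c * B c b))"

text \<open>
  \<open>Q\<close> is $P^{-1}$. A column-finite two-sided inverse of an upper triangular \<open>P\<close> is itself upper
  triangular, because \<open>P\<close> is then bijective on each span of the first $n$ unit vectors.
\<close>

definition inf_diagonalizable :: "infmat \<Rightarrow> bool" where
  "inf_diagonalizable A \<longleftrightarrow> (\<exists>P Q D.
     inf_upper_triangular P \<and> inf_upper_triangular Q \<and>
     inf_mult P Q = inf_one \<and> inf_mult Q P = inf_one \<and>
     inf_diagonal D \<and> A = inf_mult (inf_mult P D) Q)"

section \<open>The resonance system\<close>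

definition solves_system :: "nat \<Rightarrow> (nat \<Rightarrow> complex) \<Rightarrow> (nat \<Rightarrow> int) \<Rightarrow> int \<Rightarrow> bool" where
  "solves_system k lam x t \<longleftrightarrow>
     real_of_int (x 0) +
       (\<Sum>i = 1..<k. real_of_int (x i) * log (cmod (lam 0)) (cmod (lam i))) = 0 \<and>
     (\<Sum>i<k. Arg (lam i) * real_of_int (x i)) = 2 * pi * real_of_int t"

definition has_nontrivial_solution :: "nat \<Rightarrow> (nat \<Rightarrow> complex) \<Rightarrow> bool" where
  "has_nontrivial_solution k lam \<longleftrightarrow>
     (\<exists>x t. solves_system k lam x t \<and> ((\<exists>i<k. x i \<noteq> 0) \<or> t \<noteq> 0))"

end

theory Submission
  imports Defs "HOL-Combinatorics.Permutations"
begin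

text \<open>
  Triangularity of $\tilde T$ on the rows of the monomials $w_p$ kills the constant terms and makes
  ${}^{1}{\bf C}$ upper triangular, so its diagonal is a permutation of the $\lambda_i$ and the diagonal
  entries of $\tilde T$ are the products $\prod_i \lambda_i^{n_i}$, one for each monomial. If two of them
  coincide, then taking moduli and arguments turns the difference of the exponent vectors into a
  non-trivial solution of the system. Otherwise the diagonal entries are distinct, and back
  substitution yields an eigenvector for each of them.
\<close>

section \<open>Infinite upper triangular matrices\<close>

lemma inf_mult_upper:
  assumes "inf_upper_triangular B"
  shows "inf_mult A B a b = (\<Sum>c\<le>b. A a c * B c b)"
  unfolding inf_mult_def
proof (rule Sum_any.expand_superset)
  show "{c. A a c * B c b \<noteq> 0} \<subseteq> {..b}"
    using assms unfolding inf_upper_triangular_def by (auto simp: not_less[symmetric])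
qed simp

text \<open>Products with different column indices get one common summation range, as the double sum
  for associativity requires.\<close>

lemma inf_mult_upper_ext:
  assumes "inf_upper_triangular B" "b \<le> n"
  shows "inf_mult A B a b = (\<Sum>c\<le>n. A a c * B c b)"
  unfolding inf_mult_upper[OF assms(1)]
  by (rule sum.mono_neutral_left) (use assms in \<open>auto simp: inf_upper_triangular_def\<close>)

lemma inf_upper_triangular_mult:
  assumes "inf_upper_triangular A" "inf_upper_triangular B"
  shows "inf_upper_triangular (inf_mult A B)"
  unfolding inf_upper_triangular_def
proof (intro allI impI)
  fix a b :: nat assume "a > b"
  then show "inf_mult A B a b = 0"
    unfolding inf_mult_upper[OF assms(2)]
    by (intro sum.neutral ballI) (use assms(1) in \<open>auto simp: inf_upper_triangular_def\<close>)
qed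

text \<open>Triangularity of \<open>B\<close> and \<open>C\<close> confines both summation indices
  to \<open>{..b}\<close>, so this is an exchange of two finite sums.\<close>

lemma inf_mult_assoc:
  assumes "inf_upper_triangular B" "inf_upper_triangular C"
  shows "inf_mult (inf_mult A B) C = inf_mult A (inf_mult B C)"
proof (intro ext)
  fix a b
  have "inf_mult (inf_mult A B) C a b = (\<Sum>c\<le>b. (\<Sum>e\<le>b. A a e * B e c) * C c b)"
    unfolding inf_mult_upper[OF assms(2)]
    by (intro sum.cong) (auto simp: inf_mult_upper_ext[OF assms(1)])
  also have "\<dots> = (\<Sum>e\<le>b. A a e * (\<Sum>c\<le>b. B e c * C c b))"
    by (simp add: sum_distrib_left sum_distrib_right mult.assoc) (rule sum.swap)
  also have "\<dots> = inf_mult A (inf_mult B C) a b"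
    by (simp add: inf_mult_upper[OF inf_upper_triangular_mult[OF assms]]
        inf_mult_upper[OF assms(2)])
  finally show "inf_mult (inf_mult A B) C a b = inf_mult A (inf_mult B C) a b" .
qed

lemma inf_upper_triangular_one: "inf_upper_triangular inf_one"
  by (auto simp: inf_upper_triangular_def inf_one_def)

lemma inf_mult_one_right: "inf_mult A inf_one = A"
  by (intro ext) (simp add: inf_mult_upper[OF inf_upper_triangular_one],
      simp add: inf_one_def if_distrib cong: if_cong)

lemma inf_mult_one_left:
  assumes "inf_upper_triangular A"
  shows "inf_mult inf_one A = A"
proof (intro ext)
  fix a b
  have "(\<Sum>c\<le>b. inf_one a c * A c b) = (\<Sum>c\<le>b. if c = a then A a b else 0)"
    by (intro sum.cong) (auto simp: inf_one_def)
  then show "inf_mult inf_one A a b = A a b"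
    using assms by (auto simp: inf_mult_upper[OF assms] inf_upper_triangular_def)
qed

section \<open>Inverses of unitriangular matrices\<close>

definition inf_unitriangular :: "infmat \<Rightarrow> bool" where
  "inf_unitriangular A \<longleftrightarrow> inf_upper_triangular A \<and> (\<forall>a. A a a = 1)"

text \<open>Entry \<open>(a, b)\<close> of \<open>Q P = 1\<close> for \<open>a < b\<close>, solved
  for \<open>Q a b\<close>: its coefficient is \<open>P b b = 1\<close>, and the other terms involve
  only earlier columns of \<open>Q\<close>.\<close>

function left_inverse :: "infmat \<Rightarrow> infmat" where
  "left_inverse P a b =
     (if a = b then 1 else if b < a then 0 else - (\<Sum>c\<in>{a..<b}. left_inverse P a c * P c b))"
  by auto
termination by (relation "Wellfounded.measure (\<lambda>(P, a, b). b)") auto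

declare left_inverse.simps [simp del]

lemma left_inverse_diag: "left_inverse P a a = 1"
  by (subst left_inverse.simps) simp

lemma left_inverse_below: "b < a \<Longrightarrow> left_inverse P a b = 0"
  by (subst left_inverse.simps) simp

lemma left_inverse_unitriangular: "inf_unitriangular (left_inverse P)"
  by (simp add: inf_unitriangular_def inf_upper_triangular_def left_inverse_diag left_inverse_below)

lemma left_inverse_mult:
  assumes "inf_unitriangular P"
  shows "inf_mult (left_inverse P) P = inf_one"
proof (intro ext)
  fix a b
  let ?Q = "left_inverse P"
  have P: "inf_upper_triangular P" "P b b = 1"
    using assms by (auto simp: inf_unitriangular_def)
  have Q: "\<And>c. c < a \<Longrightarrow> ?Q a c = 0"
    by (rule left_inverse_below)
  have "inf_mult ?Q P a b = (\<Sum>c\<in>{a..b}. ?Q a c * P c b)"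
    unfolding inf_mult_upper[OF P(1)]
    by (rule sum.mono_neutral_right) (use Q in \<open>auto simp: not_le\<close>)
  also have "\<dots> = inf_one a b"
  proof (cases "a < b")
    case True
    then have "{a..b} = insert b {a..<b}" by auto
    moreover have "?Q a b = - (\<Sum>c\<in>{a..<b}. ?Q a c * P c b)"
      using True by (subst left_inverse.simps) simp
    ultimately show ?thesis
      using True P(2) by (simp add: inf_one_def)
  next
    case False
    then show ?thesis
      using P(2) by (cases "a = b") (auto simp: inf_one_def left_inverse_diag)
  qed
  finally show "inf_mult ?Q P a b = inf_one a b" .
qed

text \<open>The left inverse \<open>Q\<close> of \<open>P\<close> itself has a left inverse
  \<open>R\<close>, and \<open>R = R (Q P) = (R Q) P = P\<close>; thus \<open>R Q = 1\<close> says
  \<open>P Q = 1\<close>.\<close>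

lemma right_inverse_mult:
  assumes "inf_unitriangular P"
  shows "inf_mult P (left_inverse P) = inf_one"
proof -
  define Q where "Q = left_inverse P"
  define R where "R = left_inverse Q"
  have uQ: "inf_unitriangular Q" and uR: "inf_unitriangular R"
    by (simp_all add: Q_def R_def left_inverse_unitriangular)
  have QP: "inf_mult Q P = inf_one" and RQ: "inf_mult R Q = inf_one"
    using left_inverse_mult assms uQ by (simp_all add: Q_def R_def)
  have up: "inf_upper_triangular P" "inf_upper_triangular Q"
    using assms uQ by (auto simp: inf_unitriangular_def)
  have "R = inf_mult R (inf_mult Q P)"
    by (simp add: QP inf_mult_one_right)
  also have "\<dots> = P"
    by (simp add: inf_mult_assoc[OF up(2,1), symmetric] RQ inf_mult_one_left up)
  finally show ?thesis
    using RQ by (simp add: Q_def)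
qed

section \<open>Eigenvectors and diagonalization\<close>

text \<open>Column \<open>b\<close> is the eigenvector for the eigenvalue \<open>T b b\<close>, found by back substitution.\<close>

function eigenvectors :: "infmat \<Rightarrow> infmat" where
  "eigenvectors T a b =
     (if a = b then 1 else if b < a then 0
      else (\<Sum>c\<in>{a<..b}. T a c * eigenvectors T c b) / (T b b - T a a))"
  by auto
termination by (relation "Wellfounded.measure (\<lambda>(T, a, b). b - a)") auto

declare eigenvectors.simps [simp del]

lemma eigenvectors_diag: "eigenvectors T a a = 1"
  by (subst eigenvectors.simps) simp

lemma eigenvectors_below: "b < a \<Longrightarrow> eigenvectors T a b = 0"
  by (subst eigenvectors.simps) simp

lemma eigenvectors_unitriangular: "inf_unitriangular (eigenvectors T)"
  by (simp add: inf_unitriangular_def inf_upper_triangular_def eigenvectors_diag eigenvectors_below)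

text \<open>With the term \<open>c = a\<close> moved to the other side, row \<open>a\<close> of the
  eigenvalue equation for column \<open>b\<close> is the defining recursion multiplied by
  \<open>T b b - T a a\<close>. Injectivity keeps this factor nonzero.\<close>

lemma mult_eigenvectors:
  assumes T: "inf_upper_triangular T" and dist: "inj (\<lambda>a. T a a)"
  defines "D \<equiv> (\<lambda>a b. if a = b then T a a else 0)"
  shows "inf_mult T (eigenvectors T) = inf_mult (eigenvectors T) D"
proof (intro ext)
  fix a b
  let ?P = "eigenvectors T"
  have P: "inf_upper_triangular ?P"
    using eigenvectors_unitriangular by (auto simp: inf_unitriangular_def)
  have D: "inf_upper_triangular D"
    by (auto simp: D_def inf_upper_triangular_def)
  have "inf_mult ?P D a b = (\<Sum>c\<le>b. if c = b then ?P a b * T b b else 0)"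
    unfolding inf_mult_upper[OF D] by (intro sum.cong) (auto simp: D_def)
  then have PD: "inf_mult ?P D a b = ?P a b * T b b" by simp
  have "inf_mult T ?P a b = (\<Sum>c\<in>{a..b}. T a c * ?P c b)"
    unfolding inf_mult_upper[OF P]
    by (rule sum.mono_neutral_right) (use T in \<open>auto simp: inf_upper_triangular_def not_le\<close>)
  also have "\<dots> = ?P a b * T b b"
  proof (cases "a < b")
    case True
    then have "{a..b} = insert a {a<..b}" by auto
    moreover have "T b b - T a a \<noteq> 0"
      using True dist by (auto dest: injD)
    moreover have "?P a b = (\<Sum>c\<in>{a<..b}. T a c * ?P c b) / (T b b - T a a)"
      using True by (subst eigenvectors.simps) simp
    ultimately show ?thesis
      by (simp add: field_simps)
  next
    case False
    then show ?thesis
      by (cases "a = b") (auto simp: eigenvectors_diag eigenvectors_below)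
  qed
  finally show "inf_mult T ?P a b = inf_mult ?P D a b" by (simp add: PD)
qed

theorem inf_diagonalizable_distinct_diagonal:
  assumes T: "inf_upper_triangular T" and dist: "inj (\<lambda>a. T a a)"
  shows "inf_diagonalizable T"
proof -
  define P where "P = eigenvectors T"
  define D :: infmat where "D = (\<lambda>a b. if a = b then T a a else 0)"
  let ?Q = "left_inverse P"
  have uP: "inf_unitriangular P"
    by (simp add: P_def eigenvectors_unitriangular)
  have up: "inf_upper_triangular P" "inf_upper_triangular ?Q"
    using uP left_inverse_unitriangular by (auto simp: inf_unitriangular_def)
  have "inf_mult (inf_mult P D) ?Q = inf_mult (inf_mult T P) ?Q"
    using mult_eigenvectors[OF T dist] by (simp add: P_def D_def)
  also have "\<dots> = T"
    by (simp add: inf_mult_assoc up right_inverse_mult uP inf_mult_one_right)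
  finally have "T = inf_mult (inf_mult P D) ?Q" by simp
  moreover have "inf_diagonal D" by (auto simp: inf_diagonal_def D_def)
  ultimately show ?thesis
    unfolding inf_diagonalizable_def
    using up left_inverse_mult[OF uP] right_inverse_mult[OF uP] by blast
qed

section \<open>Lowest monomials\<close>

text \<open>
  Comparing index sums among monomials of the same degree is coarser than the lexicographic order,
  but it suffices to read off the diagonal and is visibly compatible with products.
\<close>

definition heavier :: "nat multiset \<Rightarrow> nat multiset \<Rightarrow> bool" where
  "heavier \<mu> \<nu> \<longleftrightarrow> size \<mu> < size \<nu> \<or> size \<mu> = size \<nu> \<and> sum_mset \<mu> < sum_mset \<nu>"

text \<open>A leading term plus a remainder can be multiplied out directly. The coefficient
  \<open>c\<close> may be 0; then all monomials of \<open>f\<close> are heavier than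
  \<open>\<mu>\<close>.\<close>

definition has_lowest :: "cpoly \<Rightarrow> nat multiset \<Rightarrow> complex \<Rightarrow> bool" where
  "has_lowest f \<mu> c \<longleftrightarrow>
     (\<exists>g. f = Poly_Mapping.single \<mu> c + g \<and> (\<forall>\<nu>\<in>Poly_Mapping.keys g. heavier \<mu> \<nu>))"

lemma has_lowest_lookup:
  assumes "has_lowest f \<mu> c"
  shows "Poly_Mapping.lookup f \<mu> = c"
proof -
  obtain g where g: "f = Poly_Mapping.single \<mu> c + g" "\<forall>\<nu>\<in>Poly_Mapping.keys g. heavier \<mu> \<nu>"
    using assms by (auto simp: has_lowest_def)
  have "\<mu> \<notin> Poly_Mapping.keys g"
    using g(2) by (auto simp: heavier_def)
  then show ?thesis by (simp add: g(1) lookup_add in_keys_iff)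
qed

lemma has_lowestI:
  assumes "\<And>\<nu>. Poly_Mapping.lookup f \<nu> \<noteq> 0 \<Longrightarrow> \<nu> = \<mu> \<or> heavier \<mu> \<nu>"
    and "Poly_Mapping.lookup f \<mu> = c"
  shows "has_lowest f \<mu> c"
  unfolding has_lowest_def
proof (intro exI[of _ "f - Poly_Mapping.single \<mu> c"] conjI ballI)
  fix \<nu> assume "\<nu> \<in> Poly_Mapping.keys (f - Poly_Mapping.single \<mu> c)"
  then show "heavier \<mu> \<nu>"
    using assms by (cases "\<nu> = \<mu>") (auto simp: in_keys_iff lookup_minus lookup_single)
qed simp

lemma has_lowest_one: "has_lowest 1 {#} 1"
  by (rule has_lowestI) (auto simp: lookup_one)

text \<open>Size and index sum are additive on multisets, and every product other than that of the
  two leading terms has a heavier factor on at least one side.\<close>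

lemma has_lowest_mult:
  assumes "has_lowest f \<mu> c" "has_lowest f' \<mu>' c'"
  shows "has_lowest (f * f') (\<mu> + \<mu>') (c * c')"
proof -
  let ?s = "Poly_Mapping.single"
  obtain g where g: "f = ?s \<mu> c + g" "\<forall>\<nu>\<in>Poly_Mapping.keys g. heavier \<mu> \<nu>"
    using assms(1) by (auto simp: has_lowest_def)
  obtain g' where g': "f' = ?s \<mu>' c' + g'" "\<forall>\<nu>\<in>Poly_Mapping.keys g'. heavier \<mu>' \<nu>"
    using assms(2) by (auto simp: has_lowest_def)
  let ?h = "?s \<mu> c * g' + g * ?s \<mu>' c' + g * g'"
  have "f * f' = ?s (\<mu> + \<mu>') (c * c') + ?h"
    by (simp add: g(1) g'(1) algebra_simps mult_single)
  moreover have "heavier (\<mu> + \<mu>') \<nu>" if "\<nu> \<in> Poly_Mapping.keys ?h" for \<nu>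
  proof -
    have "\<nu> \<in> Poly_Mapping.keys (?s \<mu> c * g') \<union> Poly_Mapping.keys (g * ?s \<mu>' c')
        \<union> Poly_Mapping.keys (g * g')"
      using that keys_add[of "?s \<mu> c * g' + g * ?s \<mu>' c'" "g * g'"]
        keys_add[of "?s \<mu> c * g'" "g * ?s \<mu>' c'"] by blast
    then obtain \<alpha> \<beta> where \<nu>: "\<nu> = \<alpha> + \<beta>"
      and "\<alpha> \<in> Poly_Mapping.keys (?s \<mu> c) \<and> \<beta> \<in> Poly_Mapping.keys g'
        \<or> \<alpha> \<in> Poly_Mapping.keys g \<and> \<beta> \<in> Poly_Mapping.keys (?s \<mu>' c')
        \<or> \<alpha> \<in> Poly_Mapping.keys g \<and> \<beta> \<in> Poly_Mapping.keys g'"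
      using keys_mult[of "?s \<mu> c" g'] keys_mult[of g "?s \<mu>' c'"] keys_mult[of g g'] by blast
    then have "\<alpha> = \<mu> \<and> heavier \<mu>' \<beta> \<or> heavier \<mu> \<alpha> \<and> \<beta> = \<mu>' \<or> heavier \<mu> \<alpha> \<and> heavier \<mu>' \<beta>"
      using g(2) g'(2) by (auto split: if_splits)
    then show ?thesis unfolding \<nu> heavier_def by auto
  qed
  ultimately show ?thesis unfolding has_lowest_def by blast
qed

lemma has_lowest_prod_list:
  assumes "\<And>l. l \<in> set ls \<Longrightarrow> has_lowest (F l) {#l#} (d l)"
  shows "has_lowest (prod_list (map F ls)) (mset ls) (prod_list (map d ls))"
  using assms
proof (induction ls)
  case (Cons l ls)
  then show ?case
    using has_lowest_mult[of "F l" "{#l#}" "d l" "prod_list (map F ls)" "mset ls"] by simp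
qed (simp add: has_lowest_one)

section \<open>Coefficients of the recurrence polynomials\<close>

lemma prod_list_map_pvar: "prod_list (map pvar ls) = Poly_Mapping.single (mset ls) 1"
  by (induction ls) (simp_all add: pvar_def mult_single)

lemma lookup_rec_poly:
  "Poly_Mapping.lookup (rec_poly k m C p) \<nu> = (C 0 p [] when {#} = \<nu>) +
     (\<Sum>j = 1..m. \<Sum>ls | length ls = j \<and> set ls \<subseteq> {..<k}. (C j p ls when mset ls = \<nu>))"
  by (simp add: rec_poly_def pconst_def prod_list_map_pvar lookup_add lookup_sum mult_single
      lookup_single)

text \<open>\<open>[q]\<close> is the only list with multiset \<open>{#q#}\<close>, so only
  \<open>j = 1\<close> contributes, and \<open>m \<ge> 1\<close> puts it in range.\<close>

lemma lookup_rec_poly_linear: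
  assumes "q < k" "m \<ge> 1"
  shows "Poly_Mapping.lookup (rec_poly k m C p) {#q#} = C 1 p [q]"
proof -
  have "(\<Sum>ls | length ls = j \<and> set ls \<subseteq> {..<k}. (C j p ls when mset ls = {#q#}))
      = (if j = 1 then C 1 p [q] else 0)" for j
  proof -
    have fin: "finite {ls. length ls = j \<and> set ls \<subseteq> {..<k}}"
      using finite_lists_length_eq[of "{..<k}" j] by (simp add: conj_commute)
    have "(\<Sum>ls | length ls = j \<and> set ls \<subseteq> {..<k}. (C j p ls when mset ls = {#q#}))
       = (\<Sum>ls | length ls = j \<and> set ls \<subseteq> {..<k}. if ls = [q] then C j p [q] else 0)"
      by (intro sum.cong) (auto simp: when_def)
    also have "\<dots> = (if j = 1 then C 1 p [q] else 0)"
      using assms(1) by (subst sum.delta[OF fin]) auto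
    finally show ?thesis .
  qed
  then show ?thesis
    using assms(2) by (simp add: lookup_rec_poly)
qed

text \<open>Root multisets recover linear factors from their product; in this way the diagonal of a
  triangular matrix is compared with the given eigenvalues.\<close>

lemma proots_prod_linear_factors:
  fixes f :: "'a \<Rightarrow> 'b::idom"
  shows "proots (\<Prod>i\<in>A. [:- f i, 1:]) = image_mset f (mset_set A)"
  by (induction A rule: infinite_finite_induct) (simp_all add: proots_mult del: mult_pCons_left)

section \<open>Enumeration of the monomials\<close>

text \<open>If \<open>s\<close> were missed, induction would keep all values of the enumeration
  below \<open>s\<close>, and there are infinitely many of them.\<close>

lemma enumerate_surj:
  fixes S :: "'a::wellorder set"
  assumes S: "infinite S" and s: "s \<in> S" and fin: "finite {x \<in> S. x < s}"
  shows "\<exists>n. enumerate S n = s"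
proof (rule ccontr)
  assume neq: "\<nexists>n. enumerate S n = s"
  have "enumerate S n < s" for n
  proof (induction n)
    case 0
    have "enumerate S 0 \<le> s"
      using s by (simp add: enumerate_0 Least_le)
    then show ?case using neq by (metis order_le_less)
  next
    case (Suc n)
    have "enumerate S (Suc n) \<le> s"
      unfolding enumerate_Suc''[OF S] using s Suc by (simp add: Least_le)
    then show ?case using neq by (metis order_le_less)
  qed
  then have "range (enumerate S) \<subseteq> {x \<in> S. x < s}"
    using enumerate_in_set[OF S] by auto
  then have "finite (range (enumerate S))"
    using fin finite_subset by blast
  then show False
    using range_inj_infinite[OF inj_enumerate[OF S]] by blast
qed

context
  fixes k :: nat
  assumes k: "k \<ge> 1"
begin

text \<open>The powers of \<open>w_0\<close> suffice; \<open>k \<ge> 1\<close> provides that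
  variable.\<close>

lemma infinite_index_lists: "infinite {ls. sorted ls \<and> set ls \<subseteq> {..<k}}"
proof
  assume fin: "finite {ls. sorted ls \<and> set ls \<subseteq> {..<k}}"
  have "range (\<lambda>n. replicate n (0::nat)) \<subseteq> {ls. sorted ls \<and> set ls \<subseteq> {..<k}}"
    using k by auto
  then have "finite (range (\<lambda>n. replicate n (0::nat)))"
    using fin finite_subset by blast
  moreover have "inj (\<lambda>n. replicate n (0::nat))"
    by (rule injI) (metis length_replicate)
  ultimately show False using range_inj_infinite by blast
qed

lemma monom_list_in: "sorted (monom_list k a)" "set (monom_list k a) \<subseteq> {..<k}"
  using enumerate_in_set[OF infinite_index_lists, of a] by (auto simp: monom_list_def)

lemma monom_list_less_iff: "monom_list k a < monom_list k b \<longleftrightarrow> a < b"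
  by (simp add: monom_list_def infinite_index_lists)

text \<open>Lists that precede \<open>ls\<close> are at most as long as \<open>ls\<close> and use
  the finite alphabet \<open>{..<k}\<close>, so there are only finitely many.\<close>

lemma monom_list_surj:
  assumes "sorted ls" "set ls \<subseteq> {..<k}"
  obtains a where "monom_list k a = ls"
proof -
  let ?S = "{ls. sorted ls \<and> set ls \<subseteq> {..<k}}"
  have "{x \<in> ?S. x < ls} \<subseteq> {xs. set xs \<subseteq> {..<k} \<and> length xs \<le> length ls}"
    by (auto simp: list_less_def lenlex_conv)
  then have "finite {x \<in> ?S. x < ls}"
    using finite_lists_length_le[of "{..<k}"] finite_subset by blast
  then show thesis
    using enumerate_surj[OF infinite_index_lists, of ls] assms that by (auto simp: monom_list_def)
qed

lemma mset_monom_list_inj: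
  assumes "mset (monom_list k a) = mset (monom_list k b)"
  shows "a = b"
proof -
  have "monom_list k a = monom_list k b"
    using assms monom_list_in(1) by (metis properties_for_sort)
  then show ?thesis
    using monom_list_less_iff[of a b] monom_list_less_iff[of b a] by (metis less_irrefl nat_neq_iff)
qed

section \<open>Consequences of triangularity\<close>

context
  fixes m C
  assumes m: "m \<ge> 1" and upper: "inf_upper_triangular (trans_matrix k m C)"
begin

text \<open>The row of the monomial \<open>w_p\<close> lists the coefficients of
  \<open>rec_poly k m C p\<close>, and monomials before \<open>w_p\<close> belong to columns left of
  the diagonal.\<close>

lemma lookup_rec_poly_eq_0:
  assumes "p < k" "sorted ls" "set ls \<subseteq> {..<k}" "ls < [p]"
  shows "Poly_Mapping.lookup (rec_poly k m C p) (mset ls) = 0"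
proof -
  obtain a where a: "monom_list k a = [p]"
    using monom_list_surj[of "[p]"] assms(1) by auto
  obtain b where b: "monom_list k b = ls"
    using monom_list_surj assms by blast
  have "b < a" using assms(4) monom_list_less_iff[of b a] by (simp add: a b)
  then have "trans_matrix k m C a b = 0"
    using upper by (auto simp: inf_upper_triangular_def)
  then show ?thesis by (simp add: trans_matrix_def a b)
qed

lemma linear_coeff_eq_0:
  assumes "q < p" "p < k"
  shows "C 1 p [q] = 0"
  using lookup_rec_poly_eq_0[of p "[q]"] lookup_rec_poly_linear[of q k m C p] assms m
  by (simp add: Cons_less_Cons)

text \<open>Triangularity removes the constant and every \<open>w_q\<close> with
  \<open>q < p\<close>. What remains besides \<open>w_p\<close> has degree one and a larger index,
  or degree above one.\<close>

lemma has_lowest_rec_poly: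
  assumes p: "p < k"
  shows "has_lowest (rec_poly k m C p) {#p#} (C 1 p [p])"
proof (rule has_lowestI)
  fix \<nu> assume nz: "Poly_Mapping.lookup (rec_poly k m C p) \<nu> \<noteq> 0"
  consider "\<nu> = {#}" | q where "\<nu> = {#q#}" | "size \<nu> > 1"
    by (metis One_nat_def less_one linorder_neqE_nat size_1_singleton_mset size_eq_0_iff_empty)
  then show "\<nu> = {#p#} \<or> heavier {#p#} \<nu>"
  proof cases
    case 1
    then show ?thesis using lookup_rec_poly_eq_0[of p "[]"] nz p by simp
  next
    case (2 q)
    then have "\<not> q < p"
      using lookup_rec_poly_eq_0[of p "[q]"] nz p by (auto simp: Cons_less_Cons)
    then show ?thesis using 2 by (auto simp: heavier_def)
  qed (auto simp: heavier_def)
next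
  show "Poly_Mapping.lookup (rec_poly k m C p) {#p#} = C 1 p [p]"
    using p m by (rule lookup_rec_poly_linear)
qed

text \<open>Lowest terms multiply, so substitution into monomial \<open>a\<close> gives a polynomial
  whose lowest monomial, in the sense of \<open>has_lowest\<close>, is again monomial
  \<open>a\<close>.\<close>

lemma trans_matrix_diagonal:
  "trans_matrix k m C a a = (\<Prod>p<k. C 1 p [p] ^ count (mset (monom_list k a)) p)"
proof -
  let ?ls = "monom_list k a"
  have "trans_matrix k m C a a = prod_list (map (\<lambda>p. C 1 p [p]) ?ls)"
    unfolding trans_matrix_def
    by (intro has_lowest_lookup has_lowest_prod_list has_lowest_rec_poly)
      (use monom_list_in(2) in auto)
  also have "\<dots> = prod_mset (image_mset (\<lambda>p. C 1 p [p]) (mset ?ls))"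
    by (metis mset_map prod_mset_prod_list)
  \<comment> \<open>Absent variables have exponent 0, so the product may run over
    \<open>{..<k}\<close>, the same range for every \<open>a\<close>.\<close>
  also have "\<dots> = (\<Prod>p<k. C 1 p [p] ^ count (mset ?ls) p)"
    unfolding image_prod_mset_multiplicity
    using monom_list_in(2)[of a]
    by (intro prod.mono_neutral_left ballI) (simp_all add: not_in_iff[THEN iffD1])
  finally show ?thesis .
qed

text \<open>Equal root multisets determine the diagonal only up to order, and the numbering of
  \<open>lam\<close> is already fixed because the system singles out \<open>lam 0\<close>.\<close>

lemma linear_matrix_diagonal_permutes:
  assumes "char_poly (linear_matrix k C) = (\<Prod>i<k. [:- lam i, 1:])"
  obtains \<pi> where "\<pi> permutes {..<k}" "\<And>p. p < k \<Longrightarrow> C 1 p [p] = lam (\<pi> p)"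
proof -
  let ?A = "linear_matrix k C"
  have "?A \<in> carrier_mat k k" by (simp add: linear_matrix_def)
  moreover have "upper_triangular ?A"
    using linear_coeff_eq_0 by (auto simp: linear_matrix_def)
  ultimately have "char_poly ?A = (\<Prod>a\<leftarrow>diag_mat ?A. [:- a, 1:])"
    by (rule char_poly_upper_triangular)
  also have "\<dots> = (\<Prod>p<k. [:- C 1 p [p], 1:])"
    by (simp add: diag_mat_def linear_matrix_def interv_sum_list_conv_sum_set_nat
        prod.list_conv_set_nth atLeast0LessThan)
  finally have "proots (\<Prod>p<k. [:- C 1 p [p], 1:]) = proots (\<Prod>i<k. [:- lam i, 1:])"
    using assms by simp
  then have "image_mset (\<lambda>p. C 1 p [p]) (mset_set {..<k}) = image_mset lam (mset_set {..<k})"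
    by (simp only: proots_prod_linear_factors)
  then obtain \<pi> where "\<pi> permutes {..<k}" "\<forall>p\<in>{..<k}. C 1 p [p] = lam (\<pi> p)"
    by (rule image_mset_eq_implies_permutes[OF finite_lessThan])
  then show thesis by (intro that) auto
qed

end

end

section \<open>Resonances\<close>

text \<open>Both products become exponentials of sums of \<open>Ln (lam i)\<close>. In the
  difference of the exponents, the real part divided by \<open>ln (cmod (lam 0))\<close> gives the
  first equation and the imaginary part the second.\<close>

lemma has_nontrivial_solution_if_resonant:
  assumes k: "k \<ge> 1" and lam: "\<And>i. i < k \<Longrightarrow> lam i \<noteq> 0" and lam0: "cmod (lam 0) \<noteq> 1"
    and eq: "(\<Prod>i<k. lam i ^ n i) = (\<Prod>i<k. lam i ^ n' i)"
    and neq: "\<exists>i<k. n i \<noteq> n' i"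
  shows "has_nontrivial_solution k lam"
proof -
  have pow: "(\<Prod>i<k. lam i ^ e i) = exp (\<Sum>i<k. of_nat (e i) * Ln (lam i))" for e :: "nat \<Rightarrow> nat"
    unfolding exp_sum[OF finite_lessThan]
    by (intro prod.cong) (auto simp: exp_of_nat_mult lam)
  \<comment> \<open>Exponents of equal exponentials differ by an integer multiple of
    \<open>2 * pi * \<i>\<close>; this integer is the \<open>t\<close> of the system.\<close>
  obtain t :: int where t: "(\<Sum>i<k. of_nat (n i) * Ln (lam i)) =
      (\<Sum>i<k. of_nat (n' i) * Ln (lam i)) + (of_int (2 * t) * pi) * \<i>"
    using eq unfolding pow exp_eq by blast
  \<comment> \<open>Taken in the integers, since subtraction on \<open>nat\<close>
    truncates.\<close>
  define x where "x = (\<lambda>i. int (n i) - int (n' i))"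
  have "(\<Sum>i<k. of_int (x i) * Ln (lam i)) = of_int (2 * t) * pi * \<i>"
    using t by (simp add: x_def algebra_simps sum_subtractf)
  then have "Re (\<Sum>i<k. of_int (x i) * Ln (lam i)) = 0"
    and "Im (\<Sum>i<k. of_int (x i) * Ln (lam i)) = 2 * pi * t"
    by simp_all
  then have re: "(\<Sum>i<k. of_int (x i) * ln (cmod (lam i))) = 0"
    and im: "(\<Sum>i<k. Arg (lam i) * of_int (x i)) = 2 * pi * t"
    using lam by (simp_all add: Arg_eq_Im_Ln mult.commute)
  \<comment> \<open>This is the denominator of every \<open>log\<close> in the system; the modulus
    is positive and differs from 1.\<close>
  have "ln (cmod (lam 0)) \<noteq> 0" using lam[of 0] lam0 k by simp
  moreover have "{..<k} = insert 0 {1..<k}" using k by auto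
  ultimately have "real_of_int (x 0) +
       (\<Sum>i = 1..<k. real_of_int (x i) * log (cmod (lam 0)) (cmod (lam i)))
      = (\<Sum>i<k. of_int (x i) * ln (cmod (lam i))) / ln (cmod (lam 0))"
    by (simp add: log_def sum_divide_distrib add_divide_distrib)
  then have "solves_system k lam x t"
    using re im by (simp add: solves_system_def)
  moreover have "\<exists>i<k. x i \<noteq> 0" using neq by (auto simp: x_def)
  ultimately show ?thesis by (auto simp: has_nontrivial_solution_def)
qed

section \<open>The case of two variables\<close>

lemma solves_system_2:
  "solves_system 2 lam x t \<longleftrightarrow>
     real_of_int (x 0) + real_of_int (x 1) * log (cmod (lam 0)) (cmod (lam 1)) = 0 \<and>
     Arg (lam 0) * real_of_int (x 0) + Arg (lam 1) * real_of_int (x 1) = 2 * pi * real_of_int t"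
proof -
  have "{1..<2} = {1::nat}" "{..<2} = {0, 1::nat}" by auto
  then show ?thesis by (simp add: solves_system_def)
qed

text \<open>Substituting \<open>x 0 = - x 1 * L\<close> into the second equation leaves
  \<open>x 1 * d = 2 * pi * t\<close>. This exhibits \<open>L\<close> and, for
  \<open>d \<noteq> 0\<close>, \<open>pi / d\<close> as quotients of integers; conversely,
  denominators are cleared.\<close>

lemma has_nontrivial_solution_2_iff:
  fixes lam :: "nat \<Rightarrow> complex"
  defines "L \<equiv> log (cmod (lam 0)) (cmod (lam 1))"
  defines "d \<equiv> Arg (lam 1) - Arg (lam 0) * L"
  shows "has_nontrivial_solution 2 lam \<longleftrightarrow> L \<in> \<rat> \<and> (d = 0 \<or> pi / d \<in> \<rat>)"
proof
  assume "has_nontrivial_solution 2 lam"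
  then obtain x t where sol: "solves_system 2 lam x t"
    and nontriv: "(\<exists>i<2. x i \<noteq> 0) \<or> t \<noteq> 0"
    by (auto simp: has_nontrivial_solution_def)
  have x0: "real_of_int (x 0) = - real_of_int (x 1) * L"
    and args: "Arg (lam 0) * real_of_int (x 0) + Arg (lam 1) * real_of_int (x 1) = 2 * pi * t"
    using sol by (auto simp: solves_system_2 L_def)
  have d: "real_of_int (x 1) * d = 2 * pi * t"
    using args unfolding x0 d_def by (simp add: algebra_simps)
  \<comment> \<open>\<open>x 1 = 0\<close> would force \<open>x 0 = 0\<close> by the first equation
    and \<open>t = 0\<close> by the reduced second one.\<close>
  have x1: "x 1 \<noteq> 0"
  proof
    assume "x 1 = 0"
    then have "x 0 = 0" "t = 0" using x0 d by simp_all
    then show False using nontriv \<open>x 1 = 0\<close> by (auto simp: less_2_cases_iff)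
  qed
  have "L = - real_of_int (x 0) / real_of_int (x 1)"
    using x0 x1 by (simp add: field_simps)
  then have "L \<in> \<rat>" by simp
  moreover have "pi / d \<in> \<rat>" if "d \<noteq> 0"
  proof -
    have "t \<noteq> 0" using d that x1 by auto
    then have "pi / d = real_of_int (x 1) / (2 * real_of_int t)"
      using d that by (simp add: field_simps)
    then show ?thesis by simp
  qed
  ultimately show "L \<in> \<rat> \<and> (d = 0 \<or> pi / d \<in> \<rat>)" by blast
next
  have Rats: "\<exists>(r::int) (s::int). s \<noteq> 0 \<and> y * s = r" if y: "y \<in> \<rat>" for y :: real
  proof -
    obtain r s :: int where "s > 0" "y = of_int r / of_int s"
      using y by (elim Rats_cases') blast
    then show ?thesis by (intro exI[of _ r] exI[of _ s]) simp
  qed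
  assume R: "L \<in> \<rat> \<and> (d = 0 \<or> pi / d \<in> \<rat>)"
  then obtain r s :: int where rs: "s \<noteq> 0" "L * s = r" using Rats[of L] by blast
  \<comment> \<open>This form covers \<open>d = 0\<close> and rational \<open>pi / d\<close> at
    once.\<close>
  have "\<exists>(p::int) (q::int). p \<noteq> 0 \<and> p * d = pi * q"
  proof (cases "d = 0")
    case True
    then show ?thesis by (intro exI[of _ 1] exI[of _ 0]) simp
  next
    case False
    then obtain p q :: int where "q \<noteq> 0" "pi / d * q = p" using R Rats[of "pi / d"] by blast
    then have "p \<noteq> 0" "p * d = pi * q" using False by (auto simp: field_simps)
    then show ?thesis by blast
  qed
  then obtain p q :: int where pq: "p \<noteq> 0" "p * d = pi * q" by blast
  \<comment> \<open>\<open>L * s = r\<close> dictates the ratio of \<open>- r\<close> to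
    \<open>s\<close>; the factor \<open>p\<close> makes \<open>x 1 * d\<close> a multiple of
    \<open>pi\<close>, and the factor 2 a multiple of \<open>2 * pi\<close>, with
    \<open>t = s * q\<close>.\<close>
  define x where "x = (\<lambda>i::nat. if i = 0 then - 2 * p * r else 2 * p * s)"
  have "Arg (lam 0) * real_of_int (x 0) + Arg (lam 1) * real_of_int (x 1) = 2 * s * (p * d)"
    by (simp add: x_def d_def rs(2)[symmetric] algebra_simps)
  also have "\<dots> = 2 * pi * real_of_int (s * q)"
    by (simp add: pq(2))
  finally have "solves_system 2 lam x (s * q)"
    unfolding solves_system_2 L_def[symmetric]
    by (simp add: x_def rs(2)[symmetric] algebra_simps)
  moreover have "x 1 \<noteq> 0" using rs(1) pq(1) by (simp add: x_def)
  ultimately show "has_nontrivial_solution 2 lam"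
    unfolding has_nontrivial_solution_def by (metis one_less_numeral_iff semiring_norm(76))
qed

section \<open>Distinctness of the diagonal entries\<close>

lemma inj_trans_matrix_diagonal:
  assumes k: "k \<ge> 1" and m: "m \<ge> 1" and upper: "inf_upper_triangular (trans_matrix k m C)"
    and char: "char_poly (linear_matrix k C) = (\<Prod>i<k. [:- lam i, 1:])"
    and lam: "\<And>i. i < k \<Longrightarrow> lam i \<noteq> 0" and lam0: "cmod (lam 0) \<noteq> 1"
    and nonres: "\<not> has_nontrivial_solution k lam"
  shows "inj (\<lambda>a. trans_matrix k m C a a)"
proof (rule injI, rule ccontr)
  fix a b assume eq: "trans_matrix k m C a a = trans_matrix k m C b b" and "a \<noteq> b"
  obtain \<pi> where \<pi>: "\<pi> permutes {..<k}" and C: "\<And>p. p < k \<Longrightarrow> C 1 p [p] = lam (\<pi> p)"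
    using linear_matrix_diagonal_permutes[OF k m upper char] by blast
  \<comment> \<open>The variable \<open>p\<close> carries the eigenvalue
    \<open>lam (\<pi> p)\<close>, so the exponent of \<open>lam i\<close> is the multiplicity of the
    variable that \<open>\<pi>\<close> sends to \<open>i\<close>.\<close>
  define e where "e a i = count (mset (monom_list k a)) (inv_into UNIV \<pi> i)" for a i
  have diag: "trans_matrix k m C a a = (\<Prod>i<k. lam i ^ e a i)" for a
  proof -
    have "trans_matrix k m C a a = (\<Prod>p<k. lam (\<pi> p) ^ e a (\<pi> p))"
      unfolding trans_matrix_diagonal[OF k m upper]
      by (intro prod.cong) (auto simp: C[unfolded One_nat_def] e_def permutes_inverses[OF \<pi>])
    also have "\<dots> = (\<Prod>i<k. lam i ^ e a i)"
      using prod.permute[OF \<pi>, of "\<lambda>i. lam i ^ e a i"] by (simp add: o_def)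
    finally show ?thesis .
  qed
  have "mset (monom_list k a) \<noteq> mset (monom_list k b)"
    using mset_monom_list_inj[OF k] \<open>a \<noteq> b\<close> by blast
  then obtain p where p: "count (mset (monom_list k a)) p \<noteq> count (mset (monom_list k b)) p"
    by (auto simp: multiset_eq_iff)
  have "p < k"
  proof (rule ccontr)
    assume "\<not> p < k"
    then have "p \<notin># mset (monom_list k c)" for c
      using monom_list_in(2)[OF k] by auto
    then show False using p by (metis not_in_iff)
  qed
  then have "\<pi> p < k" using permutes_in_image[OF \<pi>, of p] by simp
  moreover have "e a (\<pi> p) \<noteq> e b (\<pi> p)"
    using p by (simp add: e_def permutes_inverses[OF \<pi>])
  moreover have "(\<Prod>i<k. lam i ^ e a i) = (\<Prod>i<k. lam i ^ e b i)"
    using eq unfolding diag .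
  ultimately have "has_nontrivial_solution k lam"
    using k lam lam0 by (intro has_nontrivial_solution_if_resonant[of k lam "e a" "e b"]) auto
  then show False using nonres by blast
qed

theorem lemma3p3:
  fixes k m :: nat
    and C :: "nat \<Rightarrow> nat \<Rightarrow> nat list \<Rightarrow> complex"
    and z :: "nat \<Rightarrow> nat \<Rightarrow> complex"
    and lam :: "nat \<Rightarrow> complex"
  assumes "k \<ge> 1" and "m \<ge> 1"
    and "\<And>j p ls. \<lbrakk>j \<le> m; p < k; length ls = j; set ls \<subseteq> {..<k}; \<not> sorted ls\<rbrakk> \<Longrightarrow> C j p ls = 0"
    and "\<And>i p. \<lbrakk>i \<ge> 1; p < k\<rbrakk> \<Longrightarrow> z i p = peval (rec_poly k m C p) (z (i - 1))"
    and "inf_upper_triangular (trans_matrix k m C)"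
    and "char_poly (linear_matrix k C) = (\<Prod>i<k. [:- lam i, 1:])"
    and "\<And>i. i < k \<Longrightarrow> lam i \<noteq> 0"
    and "cmod (lam 0) \<noteq> 1"
  shows "(\<not> has_nontrivial_solution k lam \<longrightarrow> inf_diagonalizable (trans_matrix k m C)) \<and>
    (k = 2 \<longrightarrow>
      (\<not> has_nontrivial_solution k lam \<longleftrightarrow>
        log (cmod (lam 0)) (cmod (lam 1)) \<notin> \<rat> \<or>
        (Arg (lam 1) - Arg (lam 0) * log (cmod (lam 0)) (cmod (lam 1)) \<noteq> 0 \<and>
         pi / (Arg (lam 1) - Arg (lam 0) * log (cmod (lam 0)) (cmod (lam 1))) \<notin> \<rat>)))"
  using inf_diagonalizable_distinct_diagonal[OF assms(5)]
    inj_trans_matrix_diagonal[OF assms(1,2,5-8)] has_nontrivial_solution_2_iff[of lam]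
  by blast

end
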